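(* Let $X$ be a Hilbert space and $f : X \to \mathbb{R}$ a functional of class $C^2$. Let $x_1, x_2 \in X$ with $x_1\neq x_2$, let $\Gamma_{x_1,x_2} := \{\gamma \in C([0,1],X) : \gamma(0)=x_1,\ \gamma(1)=x_2\}$, and let $$c_0 := \inf_{\gamma \in \Gamma_{x_1,x_2}} \ \sup_{s \in [0,1]} f(\gamma(s)).$$ Suppose that $c_0 > \max\{f(x_1), f(x_2)\}$. If $f$ satisfies the Palais-Smale condition at level $c_0$, then there exists a critical point of $f$ at level $c_0$ (i.e. a point $x_0\in X$ with $\nabla f(x_0)=0$ and $f(x_0)=c_0$) that is not a local minimizer of $f$.
   Context: A sequence $(x_m)_m \subset X$ is a Palais-Smale sequence at level $c$ for $f$ if $f(x_m) \to c$ and $\nabla f(x_m) \to 0$ as $m \to +\infty$. The functional $f$ satisfies the Palais-Smale condition at level $c$ if every Palais-Smale sequence at level $c$ for $f$ has a converging subsequence. A critical point $x_0$ of $f$ is a local minimizer if there exists $r>0$ such that $f(x) \ge f(x_0)$ for all $x \in B_r(x_0)$, the ball of radius $r$ centered at $x_0$. *)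

theory Defs
  imports "HOL-Analysis.Analysis"
begin

text \<open>
  Class \<open>C\<^sup>2\<close> on the whole space, in the sense of Frechet derivatives: the first derivative
  is a map into the dual space, and it is itself differentiable with a derivative that is continuous
  for the operator norm.
\<close>

definition C2_functional :: "('a::real_normed_vector \<Rightarrow> real) \<Rightarrow> bool"
  where "C2_functional f \<longleftrightarrow>
    (\<exists>(f' :: 'a \<Rightarrow> 'a \<Rightarrow>\<^sub>L real) (f'' :: 'a \<Rightarrow> 'a \<Rightarrow>\<^sub>L ('a \<Rightarrow>\<^sub>L real)).
       (\<forall>x. (f has_derivative blinfun_apply (f' x)) (at x)) \<and>
       (\<forall>x. (f' has_derivative blinfun_apply (f'' x)) (at x)) \<and>
       continuous_on UNIV f'')"

text \<open>
  The gradient is used through the library relation \<open>GDERIV f x :> D\<close>, which says that the Frechet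
  derivative of \<open>f\<close> at \<open>x\<close> is the functional \<open>h \<mapsto> h \<bullet> D\<close>; such a \<open>D\<close> is unique. Hence the
  sequence \<open>g\<close> below is necessarily the sequence of gradients of \<open>f\<close> along \<open>x\<close>.
\<close>

definition Palais_Smale_seq :: "('a::real_inner \<Rightarrow> real) \<Rightarrow> real \<Rightarrow> (nat \<Rightarrow> 'a) \<Rightarrow> bool"
  where "Palais_Smale_seq f c x \<longleftrightarrow>
    (\<lambda>m. f (x m)) \<longlonglongrightarrow> c \<and>
    (\<exists>g. (\<forall>m. GDERIV f (x m) :> g m) \<and> g \<longlonglongrightarrow> 0)"

definition Palais_Smale_condition :: "('a::real_inner \<Rightarrow> real) \<Rightarrow> real \<Rightarrow> bool"
  where "Palais_Smale_condition f c \<longleftrightarrow>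
    (\<forall>x. Palais_Smale_seq f c x \<longrightarrow> (\<exists>r. strict_mono r \<and> convergent (x \<circ> r)))"

definition critical_point :: "('a::real_inner \<Rightarrow> real) \<Rightarrow> 'a \<Rightarrow> bool"
  where "critical_point f x \<longleftrightarrow> GDERIV f x :> 0"

definition local_minimizer :: "('a::metric_space \<Rightarrow> real) \<Rightarrow> 'a \<Rightarrow> bool"
  where "local_minimizer f x\<^sub>0 \<longleftrightarrow> (\<exists>r>0. \<forall>x\<in>ball x\<^sub>0 r. f x\<^sub>0 \<le> f x)"

definition paths_between :: "'a::topological_space \<Rightarrow> 'a \<Rightarrow> (real \<Rightarrow> 'a) set"
  where "paths_between x\<^sub>1 x\<^sub>2 = {\<gamma>. path \<gamma> \<and> pathstart \<gamma> = x\<^sub>1 \<and> pathfinish \<gamma> = x\<^sub>2}"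

text \<open>
  For continuous \<open>f\<close> on a real normed space the real-valued supremum and infimum below are genuine:
  \<open>f \<circ> \<gamma>\<close> is bounded on the compact interval, the segment from \<open>x\<^sub>1\<close> to \<open>x\<^sub>2\<close> is an admissible path,
  and every supremum is at least \<open>f x\<^sub>1\<close>.
\<close>

definition minimax_level :: "('a::topological_space \<Rightarrow> real) \<Rightarrow> 'a \<Rightarrow> 'a \<Rightarrow> real"
  where "minimax_level f x\<^sub>1 x\<^sub>2 = (INF \<gamma>\<in>paths_between x\<^sub>1 x\<^sub>2. SUP s\<in>{0..1}. f (\<gamma> s))"

end

theory Submission
  imports Defs
begin

text \<open>
  Ekeland's principle on the space of paths, combined with a first-order perturbation of an almost
  optimal path along the normalised negative gradient, produces a Palais-Smale sequence at level
  \<open>c\<^sub>0\<close> located on almost optimal paths, hence a critical point \<open>x\<close> at level \<open>c\<^sub>0\<close>. A point at this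
  level fails to be a local minimizer exactly when it lies in the closure \<open>F\<close> of \<open>{f < c\<^sub>0}\<close>. If
  \<open>x \<notin> F\<close>, then for each \<open>\<delta>\<close> strictly between \<open>0\<close> and the distance from \<open>x\<close> to \<open>F\<close>, the almost
  optimal paths, which start in \<open>F\<close> and come close to \<open>x\<close>, contain points at distance \<open>\<delta>\<close> from \<open>F\<close>.
  Near these points \<open>f \<ge> c\<^sub>0\<close>, so they are almost minima, and Ekeland's principle on small balls
  turns them into a Palais-Smale sequence; this gives a critical point at level \<open>c\<^sub>0\<close> and at
  distance exactly \<open>\<delta>\<close> from \<open>F\<close>. Letting \<open>\<delta> \<longlongrightarrow> 0\<close>, the Palais-Smale condition yields one in \<open>F\<close>.
\<close>

section \<open>Ekeland's variational principle and its first-order consequence\<close>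

text \<open>\<open>T x\<close> is the set below \<open>x\<close> in the order given by
  \<open>F w + \<epsilon> * dist x w \<le> F x\<close>. Passing repeatedly to an almost minimal
  point of the current set produces a Cauchy sequence, since distances are paid for by the decrease
  of \<open>F\<close>. No point of \<open>T z\<close> for the limit \<open>z\<close> has a smaller
  value of \<open>F\<close>, which gives the last claim. Lower semicontinuity enters as closedness
  of sublevel sets.\<close>

lemma ekeland_variational_principle:
  fixes F :: "'a::metric_space \<Rightarrow> real"
  assumes "complete S" "y \<in> S" "\<epsilon> > 0"
    and lsc: "\<And>a. closed {x \<in> S. F x \<le> a}"
    and below: "\<And>x. x \<in> S \<Longrightarrow> b \<le> F x"
  obtains z where "z \<in> S" "F z + \<epsilon> * dist y z \<le> F y"
    "\<And>w. w \<in> S \<Longrightarrow> F z - \<epsilon> * dist z w \<le> F w"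
proof -
  define T where "T x = {w \<in> S. F w + \<epsilon> * dist x w \<le> F x}" for x
  have T_refl: "x \<in> T x" if "x \<in> S" for x
    using that by (simp add: T_def)
  have T_trans: "v \<in> T x" if "w \<in> T x" "v \<in> T w" for x w v
  proof -
    have "\<epsilon> * dist x v \<le> \<epsilon> * dist x w + \<epsilon> * dist w v"
      using \<open>\<epsilon> > 0\<close> by (metis distrib_left dist_triangle less_imp_le mult_left_mono)
    with that show ?thesis
      by (auto simp: T_def)
  qed
  \<comment> \<open>The infimum over \<open>T x\<close> need not be attained, so the choice is made
    up to an error that vanishes along the iteration.\<close>
  have "\<exists>w \<in> T x. \<forall>v \<in> T x. F w \<le> F v + 1 / real (Suc n)" if "x \<in> S" for x n
  proof -
    have bdd: "bdd_below (F ` T x)"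
      using below by (auto simp: T_def intro!: bdd_belowI[of _ b])
    have "\<exists>w \<in> T x. F w < Inf (F ` T x) + 1 / real (Suc n)"
      using cInf_lessD[of "F ` T x" "Inf (F ` T x) + 1 / real (Suc n)"] T_refl[OF that]
      by auto
    moreover have "Inf (F ` T x) \<le> F v" if "v \<in> T x" for v
      using bdd that by (simp add: cInf_lower)
    ultimately show ?thesis
      by (smt (verit))
  qed
  then obtain g where g: "\<And>x n. x \<in> S \<Longrightarrow> g x n \<in> T x"
    "\<And>x n v. x \<in> S \<Longrightarrow> v \<in> T x \<Longrightarrow> F (g x n) \<le> F v + 1 / real (Suc n)"
    by metis
  define X where "X = rec_nat y (\<lambda>n x. g x n)"
  have X_0: "X 0 = y" and X_Suc: "X (Suc n) = g (X n) n" for n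
    by (simp_all add: X_def)
  have X_S: "X n \<in> S" for n
  proof (induction n)
    case (Suc n)
    then show ?case
      using g(1) by (auto simp: X_Suc T_def)
  qed (simp add: X_0 assms)
  have X_T: "X (n + k) \<in> T (X n)" for n k
  proof (induction k)
    case (Suc k)
    then show ?case
      using T_trans g(1)[OF X_S] by (metis X_Suc add_Suc_right)
  qed (simp add: T_refl X_S)
  have X_dist: "\<epsilon> * dist (X n) (X m) \<le> F (X n) - F (X m)" if "n \<le> m" for n m
    using X_T[of n "m - n"] that by (auto simp: T_def)
  have X_mono: "F (X m) \<le> F (X n)" if "n \<le> m" for n m
    using X_dist[OF that] \<open>\<epsilon> > 0\<close>
    by (smt (verit) mult_nonneg_nonneg zero_le_dist)
  have "Cauchy X"
  proof (rule metric_CauchyI)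
    fix e :: real
    assume "e > 0"
    \<comment> \<open>The values decrease and are bounded below, hence converge;
      \<open>X_dist\<close> transfers the Cauchy property from values to points.\<close>
    have "decseq (\<lambda>n. F (X n))"
      using X_mono by (simp add: decseq_def)
    then have "convergent (\<lambda>n. F (X n))"
      using below[OF X_S] by (metis convergentI decseq_convergent)
    then obtain M where M: "\<And>m n. m \<ge> M \<Longrightarrow> n \<ge> M \<Longrightarrow> dist (F (X m)) (F (X n)) < \<epsilon> * e"
      using metric_CauchyD[OF convergent_Cauchy, of "\<lambda>n. F (X n)" "\<epsilon> * e"] \<open>e > 0\<close> \<open>\<epsilon> > 0\<close>
      by auto
    have "dist (X n) (X m) < e" if "n \<ge> M" "m \<ge> n" for m n
    proof -
      have "\<epsilon> * dist (X n) (X m) < \<epsilon> * e"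
        using X_dist[of n m] M[of n m] that by (simp add: dist_real_def)
      then show ?thesis
        using \<open>\<epsilon> > 0\<close> by simp
    qed
    then show "\<exists>M. \<forall>m\<ge>M. \<forall>n\<ge>M. dist (X m) (X n) < e"
      by (metis dist_commute nat_le_linear)
  qed
  then obtain z where z: "z \<in> S" "X \<longlonglongrightarrow> z"
    using \<open>complete S\<close> X_S unfolding complete_def by blast
  have F_z: "F z \<le> F (X n)" for n
  proof -
    \<comment> \<open>From index \<open>n\<close> on the sequence stays in a closed sublevel set,
      which therefore contains the limit.\<close>
    have "eventually (\<lambda>m. X m \<in> {x \<in> S. F x \<le> F (X n)}) sequentially"
      using X_mono X_S by (auto simp: eventually_sequentially)
    from Lim_in_closed_set[OF lsc this _ z(2)] show ?thesis
      by simp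
  qed
  have z_T: "z \<in> T (X n)" for n
  proof -
    have "(\<lambda>m. F z + \<epsilon> * dist (X n) (X m)) \<longlonglongrightarrow> F z + \<epsilon> * dist (X n) z"
      by (intro tendsto_intros z)
    moreover have "F z + \<epsilon> * dist (X n) (X m) \<le> F (X n)" if "m \<ge> n" for m
      using X_dist[OF that] F_z[of m] by simp
    ultimately have "F z + \<epsilon> * dist (X n) z \<le> F (X n)"
      by (intro LIMSEQ_le_const2) auto
    with z show ?thesis
      by (simp add: T_def)
  qed
  have "F z - \<epsilon> * dist z w \<le> F w" if "w \<in> S" for w
  proof (rule ccontr)
    assume less: "\<not> ?thesis"
    then have "w \<in> T z"
      using that by (simp add: T_def)
    \<comment> \<open>By transitivity \<open>w\<close> lies in \<open>T (X n)\<close>, over which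
      \<open>X (Suc n)\<close> minimizes \<open>F\<close> up to
      \<open>1 / real (Suc n)\<close>.\<close>
    have "F z \<le> F w + 1 / real (Suc n)" for n
      using g(2)[OF X_S T_trans[OF z_T \<open>w \<in> T z\<close>], of n n] F_z[of "Suc n"]
      by (simp add: X_Suc)
    moreover have "(\<lambda>n. F w + 1 / real (Suc n)) \<longlonglongrightarrow> F w + 0"
      by (intro tendsto_intros LIMSEQ_Suc[OF lim_1_over_n])
    ultimately have "F z \<le> F w"
      by (intro LIMSEQ_le_const[of _ "F w"]) auto
    with less \<open>\<epsilon> > 0\<close> show False
      by (smt (verit) mult_nonneg_nonneg zero_le_dist)
  qed
  with that[of z] z z_T[of 0] show ?thesis
    by (auto simp: T_def X_0)
qed

text \<open>Difference quotients from the right along \<open>h\<close> are at least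
  \<open>- (\<epsilon> * norm h)\<close>: for small steps the moved point stays in \<open>S\<close>
  because \<open>z\<close> is interior. Using \<open>- h\<close> as well gives the other
  sign.\<close>

lemma derivative_bound_at_almost_minimum:
  fixes f :: "'a::real_normed_vector \<Rightarrow> real"
  assumes "(f has_derivative f') (at z)" "z \<in> interior S"
    and min: "\<And>w. w \<in> S \<Longrightarrow> f z - \<epsilon> * dist z w \<le> f w"
  shows "\<bar>f' h\<bar> \<le> \<epsilon> * norm h"
proof -
  have "- (\<epsilon> * norm h) \<le> f' h" for h
  proof -
    interpret f': bounded_linear f'
      using assms(1) by (rule has_derivative_bounded_linear)
    let ?\<phi> = "\<lambda>t. f (z + t *\<^sub>R h)"
    have "((\<lambda>t. z + t *\<^sub>R h) has_derivative (\<lambda>t. t *\<^sub>R h)) (at 0)"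
      by (auto intro!: derivative_eq_intros)
    from has_derivative_compose[OF this, of f f'] assms(1)
    have "(?\<phi> has_derivative (\<lambda>t. f' (t *\<^sub>R h))) (at 0)"
      by simp
    moreover have "(\<lambda>t. f' (t *\<^sub>R h)) = (*) (f' h)"
      by (auto simp: f'.scaleR)
    ultimately have "(?\<phi> has_field_derivative f' h) (at 0)"
      by (simp add: has_field_derivative_def)
    then have "(?\<phi> has_field_derivative f' h) (at_right 0)"
      by (rule has_field_derivative_at_within)
    then have lim: "((\<lambda>t. (?\<phi> t - f z) / t) \<longlongrightarrow> f' h) (at_right 0)"
      by (simp add: has_field_derivative_iff)
    have "((\<lambda>t. z + t *\<^sub>R h) \<longlongrightarrow> z + 0 *\<^sub>R h) (at_right 0)"
      by (intro tendsto_intros)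
    then have "\<forall>\<^sub>F t in at_right 0. z + t *\<^sub>R h \<in> interior S"
      using assms(2) by (auto dest!: topological_tendstoD[of _ _ _ "interior S"])
    moreover have "\<forall>\<^sub>F t in at_right 0. (0::real) < t"
      by (simp add: eventually_at_right_less)
    ultimately have "\<forall>\<^sub>F t in at_right 0. - (\<epsilon> * norm h) \<le> (?\<phi> t - f z) / t"
    proof eventually_elim
      case (elim t)
      then have "f z - \<epsilon> * (t * norm h) \<le> ?\<phi> t"
        using min[of "z + t *\<^sub>R h"] interior_subset by (auto simp: dist_norm)
      with elim show ?case
        by (simp add: field_simps)
    qed
    from tendsto_lowerbound[OF lim this] show ?thesis
      by simp
  qed
  from this[of h] this[of "- h"] show ?thesis
    using linear_neg[OF has_derivative_linear[OF assms(1)], of h] by simp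
qed

section \<open>Riesz representation, gradients and the mean value formula\<close>

text \<open>A representing vector is a critical point of the convex functional \<open>J\<close>.
  Ekeland's principle supplies points where the derivative of \<open>J\<close> is small, and these
  form a Cauchy sequence whose limit represents \<open>\<phi>\<close>.\<close>

lemma riesz_representation:
  fixes \<phi> :: "'a::{real_inner, complete_space} \<Rightarrow> real"
  assumes "bounded_linear \<phi>"
  obtains v where "\<And>h. \<phi> h = h \<bullet> v"
proof -
  interpret bounded_linear \<phi> by fact
  define J where "J x = (x \<bullet> x) / 2 - \<phi> x" for x
  have deriv: "(J has_derivative (\<lambda>h. h \<bullet> x - \<phi> h)) (at x)" for x
    unfolding J_def
    by (auto intro!: derivative_eq_intros has_derivative simp: inner_commute)
  have "continuous_on UNIV J"
    using deriv has_derivative_continuous by (metis continuous_at_imp_continuous_on)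
  then have closed: "closed {x \<in> UNIV. J x \<le> a}" for a
    using closed_Collect_le[of J "\<lambda>_. a"] by simp
  \<comment> \<open>The bound comes from completing the square in \<open>norm x\<close>.\<close>
  have below: "- (onorm \<phi>)\<^sup>2 / 2 \<le> J x" for x
  proof -
    have "\<phi> x \<le> onorm \<phi> * norm x"
      using onorm[OF assms, of x] by simp
    moreover have "0 \<le> (norm x - onorm \<phi>)\<^sup>2"
      by simp
    ultimately show ?thesis
      by (simp add: J_def power2_eq_square algebra_simps flip: power2_norm_eq_inner)
  qed
  have "\<exists>x. \<forall>h. \<bar>h \<bullet> x - \<phi> h\<bar> \<le> 1 / real (Suc n) * norm h" for n
  proof -
    obtain z where "\<And>w. J z - 1 / real (Suc n) * dist z w \<le> J w"
      using ekeland_variational_principle[of UNIV 0 "1 / real (Suc n)" J, OF _ _ _ closed below]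
      by (auto simp: complete_UNIV)
    then have "\<bar>h \<bullet> z - \<phi> h\<bar> \<le> 1 / real (Suc n) * norm h" for h
      by (intro derivative_bound_at_almost_minimum[OF deriv[of z], of UNIV]) auto
    then show ?thesis
      by blast
  qed
  then obtain X where X: "\<And>n h. \<bar>h \<bullet> X n - \<phi> h\<bar> \<le> 1 / real (Suc n) * norm h"
    by metis
  \<comment> \<open>Testing both estimates with the difference of the two points cancels
    \<open>\<phi>\<close>.\<close>
  have dist_X: "dist (X m) (X n) \<le> 1 / real (Suc m) + 1 / real (Suc n)" for m n
  proof -
    let ?h = "X m - X n"
    have "norm ?h * norm ?h = ?h \<bullet> ?h"
      by (metis power2_eq_square power2_norm_eq_inner)
    also have "\<dots> = (?h \<bullet> X m - \<phi> ?h) - (?h \<bullet> X n - \<phi> ?h)"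
      by (simp add: inner_diff_right)
    also have "\<dots> \<le> (1 / real (Suc m) + 1 / real (Suc n)) * norm ?h"
      using X[of ?h m] X[of ?h n] unfolding distrib_right by linarith
    finally have "norm ?h \<le> 1 / real (Suc m) + 1 / real (Suc n)"
      by (cases "norm ?h = 0") auto
    then show ?thesis
      by (simp add: dist_norm)
  qed
  have "Cauchy X"
  proof (rule metric_CauchyI)
    fix e :: real
    assume "e > 0"
    then obtain M where M: "1 / real (Suc M) < e / 2"
      using nat_approx_posE[of "e / 2"] by auto
    have "dist (X m) (X n) < e" if "m \<ge> M" "n \<ge> M" for m n
    proof -
      have "1 / real (Suc m) \<le> 1 / real (Suc M)" "1 / real (Suc n) \<le> 1 / real (Suc M)"
        using that by (auto simp: frac_le)
      with dist_X[of m n] M show ?thesis by linarith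
    qed
    then show "\<exists>M. \<forall>m\<ge>M. \<forall>n\<ge>M. dist (X m) (X n) < e"
      by blast
  qed
  then obtain v where v: "X \<longlonglongrightarrow> v"
    using Cauchy_convergent convergentD by blast
  have "\<phi> h = h \<bullet> v" for h
  proof -
    have "(\<lambda>n. \<bar>h \<bullet> X n - \<phi> h\<bar>) \<longlonglongrightarrow> \<bar>h \<bullet> v - \<phi> h\<bar>"
      by (intro tendsto_intros v)
    moreover have "(\<lambda>n. 1 / real (Suc n) * norm h) \<longlonglongrightarrow> 0 * norm h"
      by (intro tendsto_intros LIMSEQ_Suc[OF lim_1_over_n])
    ultimately have "\<bar>h \<bullet> v - \<phi> h\<bar> \<le> 0 * norm h"
      using X by (intro LIMSEQ_le) auto
    then show ?thesis by simp
  qed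
  then show ?thesis
    using that by blast
qed

text \<open>The gradients are the Riesz vectors of \<open>f' x\<close>. Testing
  \<open>f' x - f' y\<close> with \<open>D x - D y\<close> bounds the distance of gradients by the
  operator norm, so \<open>D\<close> inherits the continuity of the differentiable map
  \<open>f'\<close>.\<close>

lemma C2_functional_gradient:
  fixes f :: "'a::{real_inner, complete_space} \<Rightarrow> real"
  assumes "C2_functional f"
  obtains D where "\<And>x. GDERIV f x :> D x" "continuous_on UNIV D"
proof -
  obtain f' :: "'a \<Rightarrow> 'a \<Rightarrow>\<^sub>L real" and f'' :: "'a \<Rightarrow> 'a \<Rightarrow>\<^sub>L ('a \<Rightarrow>\<^sub>L real)"
    where f': "\<And>x. (f has_derivative blinfun_apply (f' x)) (at x)"
      and f'': "\<And>x. (f' has_derivative blinfun_apply (f'' x)) (at x)"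
    using assms unfolding C2_functional_def by blast
  have "\<exists>v. \<forall>h. f' x h = h \<bullet> v" for x
    using riesz_representation[OF blinfun.bounded_linear_right[of "f' x"]] by metis
  then obtain D where D: "\<And>x h. f' x h = h \<bullet> D x"
    by metis
  have dist_D: "dist (D x) (D y) \<le> dist (f' x) (f' y)" for x y
  proof -
    let ?h = "D x - D y"
    have "norm ?h * norm ?h = ?h \<bullet> ?h"
      by (metis power2_eq_square power2_norm_eq_inner)
    also have "\<dots> = (f' x - f' y) ?h"
      by (simp add: minus_blinfun.rep_eq D inner_diff_right)
    also have "\<dots> \<le> norm (f' x - f' y) * norm ?h"
      using norm_blinfun[of "f' x - f' y" ?h] by simp
    finally show ?thesis
      by (cases "norm ?h = 0") (auto simp: dist_norm)
  qed
  have "continuous_on UNIV f'"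
    using f'' has_derivative_continuous by (metis continuous_at_imp_continuous_on)
  then have "continuous_on UNIV D"
    unfolding continuous_on_iff by (meson dist_D order.strict_trans1)
  moreover have "GDERIV f x :> D x" for x
    using f'[of x] by (simp add: gderiv_def flip: D)
  ultimately show ?thesis
    using that by blast
qed

lemma gderiv_continuous_on:
  assumes "\<And>x. GDERIV f x :> D x"
  shows "continuous_on UNIV f"
proof (intro continuous_at_imp_continuous_on ballI)
  show "isCont f x" for x
    using assms[of x] unfolding gderiv_def by (rule has_derivative_continuous)
qed

lemma gderiv_mean_value:
  fixes f :: "'a::real_inner \<Rightarrow> real"
  assumes "\<And>x. GDERIV f x :> D x"
  shows "\<exists>u\<in>{0..1}. f (p + h) - f p = h \<bullet> D (p + u *\<^sub>R h)"
proof -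
  have *: "((\<lambda>u. f (p + u *\<^sub>R h)) has_derivative (\<lambda>t. (t *\<^sub>R h) \<bullet> D (p + u *\<^sub>R h))) (at u within {0..1})"
    for u
  proof -
    have "((\<lambda>u. p + u *\<^sub>R h) has_derivative (\<lambda>t. t *\<^sub>R h)) (at u within {0..1})"
      by (auto intro!: derivative_eq_intros)
    from has_derivative_compose[OF this] assms show ?thesis
      unfolding gderiv_def by blast
  qed
  from mvt_very_simple[OF zero_le_one *] show ?thesis
    by fastforce
qed

section \<open>Maxima along a path and their perturbation\<close>

text \<open>The inner supremum of \<open>minimax_level\<close>, named so that it can serve as the
  functional on path space to which Ekeland's principle is applied.\<close>

definition path_max :: "('a::topological_space \<Rightarrow> real) \<Rightarrow> (real \<Rightarrow> 'a) \<Rightarrow> real"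
  where "path_max f \<gamma> = (SUP s\<in>{0..1}. f (\<gamma> s))"

lemma path_max_attained:
  assumes "continuous_on UNIV f" "continuous_on {0..1} \<gamma>"
  obtains s where "s \<in> {0..1}" "f (\<gamma> s) = path_max f \<gamma>"
    "\<And>s. s \<in> {0..1} \<Longrightarrow> f (\<gamma> s) \<le> path_max f \<gamma>"
proof -
  have "continuous_on {0..1} (\<lambda>s. f (\<gamma> s))"
    by (rule continuous_on_compose2[OF assms]) simp
  then obtain s where s: "s \<in> {0..1}" "\<And>u. u \<in> {0..1} \<Longrightarrow> f (\<gamma> u) \<le> f (\<gamma> s)"
    using continuous_attains_sup[OF compact_Icc, of 0 1 "\<lambda>s. f (\<gamma> s)"] by force
  then have "path_max f \<gamma> = f (\<gamma> s)"
    unfolding path_max_def by (intro cSup_eq_maximum) auto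
  with s that show ?thesis
    by auto
qed

lemma path_max_le_iff:
  assumes "continuous_on UNIV f" "continuous_on {0..1} \<gamma>"
  shows "path_max f \<gamma> \<le> a \<longleftrightarrow> (\<forall>s\<in>{0..1}. f (\<gamma> s) \<le> a)"
  by (rule path_max_attained[OF assms]) force

text \<open>The path is shifted by small multiples of a field \<open>V\<close> pointing against the
  gradient. By \<open>min\<close> the maximum drops at rate at most \<open>\<epsilon>\<close>. As
  the shifts shrink, maximum points of the shifted paths accumulate at a maximum point of the path
  itself, where the slope along \<open>V\<close> is at least \<open>- \<epsilon>\<close>; this
  forces a short gradient.\<close>

lemma almost_critical_point_on_path:
  fixes f :: "'a::real_inner \<Rightarrow> real" and \<gamma> :: "real \<Rightarrow>\<^sub>C 'a"
  assumes grad: "\<And>x. GDERIV f x :> D x" and cont_D: "continuous_on UNIV D"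
    and ends: "f (\<gamma> 0) < path_max f \<gamma>" "f (\<gamma> 1) < path_max f \<gamma>"
    and "\<epsilon> > 0"
    and min: "\<And>\<eta>. apply_bcontfun \<eta> 0 = \<gamma> 0 \<Longrightarrow> apply_bcontfun \<eta> 1 = \<gamma> 1 \<Longrightarrow>
      path_max f \<gamma> - \<epsilon> * dist \<gamma> \<eta> \<le> path_max f (apply_bcontfun \<eta>)"
  obtains s where "s \<in> {0..1}" "f (\<gamma> s) = path_max f \<gamma>" "norm (D (\<gamma> s)) \<le> \<epsilon>"
proof -
  have cont_f: "continuous_on UNIV f"
    using grad by (rule gderiv_continuous_on)
  define M where "M = path_max f \<gamma>"
  define m where "m = max (f (\<gamma> 0)) (f (\<gamma> 1))"
  have "m < M"
    using ends by (simp add: m_def M_def)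
  have f_le_M: "f (\<gamma> s) \<le> M" if "s \<in> {0..1}" for s
    using path_max_attained[OF cont_f, of \<gamma>] that unfolding M_def by force
  \<comment> \<open>The cutoff \<open>\<psi>\<close> fixes the endpoints of the path and is \<open>1\<close> where \<open>f \<circ> \<gamma>\<close> is maximal.\<close>
  define \<psi> where "\<psi> s = max 0 (min 1 ((f (\<gamma> s) - m) / (M - m)))" for s
  \<comment> \<open>The denominator never vanishes, so \<open>V\<close> is continuous even where the
    gradient is zero; it also keeps \<open>V\<close> bounded by \<open>1\<close>, and it equals the
    norm where the gradient is longer than \<open>\<epsilon>\<close>.\<close>
  define V where "V s = - (\<psi> s / max (norm (D (\<gamma> s))) \<epsilon>) *\<^sub>R D (\<gamma> s)" for s
  have cont_f_\<gamma>: "continuous_on UNIV (\<lambda>s. f (\<gamma> s))"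
    by (rule continuous_on_compose2[OF cont_f]) auto
  have cont_D_\<gamma>: "continuous_on UNIV (\<lambda>s. D (\<gamma> s))"
    by (rule continuous_on_compose2[OF cont_D]) auto
  have max_nz: "max (norm (D (\<gamma> s))) \<epsilon> \<noteq> 0" for s
    using \<open>\<epsilon> > 0\<close> by auto
  have cont_V: "continuous_on UNIV V"
    unfolding V_def \<psi>_def using \<open>m < M\<close> max_nz
    by (intro continuous_intros cont_f_\<gamma> cont_D_\<gamma>) auto
  have norm_V: "norm (V s) \<le> 1" for s
  proof -
    have "norm (V s) = \<psi> s * (norm (D (\<gamma> s)) / max (norm (D (\<gamma> s))) \<epsilon>)"
      using \<open>\<epsilon> > 0\<close> by (simp add: V_def \<psi>_def)
    also have "\<dots> \<le> 1 * 1"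
      using \<open>\<epsilon> > 0\<close> by (intro mult_mono) (auto simp: \<psi>_def divide_le_eq_1)
    finally show ?thesis
      by simp
  qed
  have "V \<in> bcontfun"
    using cont_V norm_V by (rule bcontfun_normI)
  then obtain v where v: "V = apply_bcontfun v"
    by (rule bcontfunE)
  have "V s = 0" if "f (\<gamma> s) \<le> m" for s
    using \<open>m < M\<close> divide_nonpos_pos[of "f (\<gamma> s) - m" "M - m"] that by (simp add: V_def \<psi>_def)
  then have "V 0 = 0" "V 1 = 0"
    by (simp_all add: m_def)
  define t where "t n = 1 / real (Suc n)" for n
  have t_pos: "t n > 0" for n
    by (simp add: t_def)
  \<comment> \<open>The shift has length at most \<open>t n\<close> and fixes the ends, where
    \<open>V\<close> vanishes, so \<open>min\<close> applies; \<open>s\<close> is a maximum point of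
    the shifted path.\<close>
  have "\<exists>s\<in>{0..1}. M - \<epsilon> * t n \<le> f (\<gamma> s + t n *\<^sub>R V s)" for n
  proof -
    let ?\<eta> = "\<gamma> + t n *\<^sub>R v"
    have "norm v \<le> 1"
      using norm_V by (intro norm_bound) (simp add: v)
    then have "dist \<gamma> ?\<eta> \<le> t n"
      using t_pos[of n] by (simp add: dist_norm)
    then have "M - \<epsilon> * t n \<le> M - \<epsilon> * dist \<gamma> ?\<eta>"
      using \<open>\<epsilon> > 0\<close> by simp
    also have "\<dots> \<le> path_max f ?\<eta>"
      unfolding M_def using \<open>V 0 = 0\<close> \<open>V 1 = 0\<close> by (intro min) (auto simp: v)
    finally have le: "M - \<epsilon> * t n \<le> path_max f ?\<eta>" .
    obtain s where "s \<in> {0..1}" "f (?\<eta> s) = path_max f ?\<eta>"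
      using path_max_attained[OF cont_f continuous_on_apply_bcontfun] by blast
    with le show ?thesis
      by (intro bexI[of _ s]) (simp_all add: v)
  qed
  then obtain S where S: "\<And>n. S n \<in> {0..1}" "\<And>n. M - \<epsilon> * t n \<le> f (\<gamma> (S n) + t n *\<^sub>R V (S n))"
    by metis
  have "\<exists>u\<in>{0..1}. f (\<gamma> (S n) + t n *\<^sub>R V (S n)) - f (\<gamma> (S n)) =
      (t n *\<^sub>R V (S n)) \<bullet> D (\<gamma> (S n) + u *\<^sub>R (t n *\<^sub>R V (S n)))" for n
    by (rule gderiv_mean_value[OF grad])
  then obtain u where u: "\<And>n. u n \<in> {0..1::real}"
    "\<And>n. f (\<gamma> (S n) + t n *\<^sub>R V (S n)) - f (\<gamma> (S n)) =
      (t n *\<^sub>R V (S n)) \<bullet> D (\<gamma> (S n) + u n *\<^sub>R (t n *\<^sub>R V (S n)))"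
    by metis
  \<comment> \<open>Since \<open>f (\<gamma> (S n)) \<le> M\<close>, the lower bound on the shifted
    value bounds the increment, which the mean value formula expresses by the gradient; dividing by
    \<open>t n\<close> gives the slope.\<close>
  have slope: "- \<epsilon> \<le> V (S n) \<bullet> D (\<gamma> (S n) + (u n * t n) *\<^sub>R V (S n))" for n
  proof -
    have "t n * - \<epsilon> \<le> t n * (V (S n) \<bullet> D (\<gamma> (S n) + (u n * t n) *\<^sub>R V (S n)))"
      using S(2)[of n] u(2)[of n] f_le_M[OF S(1)[of n]] by (simp add: mult.commute)
    with t_pos[of n] show ?thesis
      by (simp only: mult_le_cancel_left_pos)
  qed
  obtain s r where s: "s \<in> {0..1}" "strict_mono r" "(S \<circ> r) \<longlonglongrightarrow> s"
    using compact_Icc[of "0::real" 1] S(1) unfolding compact_def by metis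
  then have S_r: "(\<lambda>n. S (r n)) \<longlonglongrightarrow> s"
    by (simp add: o_def)
  have lim_at: "(\<lambda>n. g (h n)) \<longlonglongrightarrow> g l" if "continuous_on UNIV g" "h \<longlonglongrightarrow> l"
    for g :: "'b::topological_space \<Rightarrow> 'c::topological_space" and h and l
    using continuous_on_tendsto_compose[OF that] by simp
  have "t \<longlonglongrightarrow> 0"
    unfolding t_def by (rule LIMSEQ_Suc[OF lim_1_over_n])
  then have t_r: "(\<lambda>n. t (r n)) \<longlonglongrightarrow> 0"
    using LIMSEQ_subseq_LIMSEQ[OF _ s(2)] by (simp add: o_def)
  have ut_r: "(\<lambda>n. u (r n) * t (r n)) \<longlonglongrightarrow> 0"
    using t_pos u(1) by (intro Lim_null_comparison[OF _ t_r] always_eventually)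
      (auto simp: abs_mult less_imp_le intro!: mult_left_le_one_le)
  have V_r: "(\<lambda>n. V (S (r n))) \<longlonglongrightarrow> V s"
    using lim_at[OF cont_V S_r] .
  have \<gamma>_r: "(\<lambda>n. \<gamma> (S (r n))) \<longlonglongrightarrow> \<gamma> s"
    using lim_at[OF continuous_on_apply_bcontfun S_r] .
  have "(\<lambda>n. \<gamma> (S (r n)) + (u (r n) * t (r n)) *\<^sub>R V (S (r n))) \<longlonglongrightarrow> \<gamma> s + 0 *\<^sub>R V s"
    by (intro tendsto_intros \<gamma>_r ut_r V_r)
  then have "(\<lambda>n. D (\<gamma> (S (r n)) + (u (r n) * t (r n)) *\<^sub>R V (S (r n)))) \<longlonglongrightarrow> D (\<gamma> s)"
    using lim_at[OF cont_D] by simp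
  from tendsto_inner[OF V_r this] slope
  have slope_s: "- \<epsilon> \<le> V s \<bullet> D (\<gamma> s)"
    by (intro LIMSEQ_le_const) auto
  have "(\<lambda>n. \<gamma> (S (r n)) + t (r n) *\<^sub>R V (S (r n))) \<longlonglongrightarrow> \<gamma> s + 0 *\<^sub>R V s"
    by (intro tendsto_intros \<gamma>_r t_r V_r)
  then have "(\<lambda>n. f (\<gamma> (S (r n)) + t (r n) *\<^sub>R V (S (r n)))) \<longlonglongrightarrow> f (\<gamma> s)"
    using lim_at[OF cont_f] by simp
  moreover have "(\<lambda>n. M - \<epsilon> * t (r n)) \<longlonglongrightarrow> M - \<epsilon> * 0"
    by (intro tendsto_intros t_r)
  ultimately have "M - \<epsilon> * 0 \<le> f (\<gamma> s)"
    using S(2) by (intro LIMSEQ_le[of "\<lambda>n. M - \<epsilon> * t (r n)"]) auto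
  with f_le_M[OF s(1)] have f_s: "f (\<gamma> s) = M"
    by simp
  have "norm (D (\<gamma> s)) \<le> \<epsilon>"
  proof (rule ccontr)
    assume less: "\<not> ?thesis"
    \<comment> \<open>Because \<open>f (\<gamma> s) = M\<close>, the cutoff is \<open>1\<close> and
      \<open>V s\<close> is exactly the normalised negative gradient.\<close>
    then have "V s = - (1 / norm (D (\<gamma> s))) *\<^sub>R D (\<gamma> s)"
      using \<open>m < M\<close> by (simp add: V_def \<psi>_def f_s)
    then have "V s \<bullet> D (\<gamma> s) = - norm (D (\<gamma> s))"
      using less \<open>\<epsilon> > 0\<close> by (simp add: power2_eq_square flip: power2_norm_eq_inner)
    with slope_s less show False
      by simp
  qed
  with that[OF s(1)] f_s show ?thesis
    by (simp add: M_def)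
qed

section \<open>Paths that almost attain the minimax level\<close>

text \<open>A real-valued \<open>INF\<close> is known to be a lower bound only for a family bounded
  below; the value \<open>f x\<close> at the common starting point provides the bound.\<close>

lemma minimax_level_le_path_max:
  fixes f :: "'a::topological_space \<Rightarrow> real"
  assumes cont_f: "continuous_on UNIV f" and "\<gamma> \<in> paths_between x y"
  shows "minimax_level f x y \<le> path_max f \<gamma>"
proof -
  have "f x \<le> path_max f \<eta>" if "\<eta> \<in> paths_between x y" for \<eta>
  proof -
    have "continuous_on {0..1} \<eta>" "\<eta> 0 = x"
      using that by (auto simp: paths_between_def path_def pathstart_def)
    then show ?thesis
      using path_max_attained[OF cont_f, of \<eta>] by force
  qed
  then have "bdd_below (path_max f ` paths_between x y)"
    by (intro bdd_belowI[of _ "f x"]) auto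
  with assms(2) show ?thesis
    unfolding minimax_level_def path_max_def[symmetric] by (intro cINF_lower)
qed

lemma path_max_less_minimax_level_add:
  fixes f :: "'a::real_normed_vector \<Rightarrow> real"
  assumes "e > 0"
  obtains \<gamma> :: "real \<Rightarrow>\<^sub>C 'a" where "\<gamma> 0 = x" "\<gamma> 1 = y" "path_max f \<gamma> < minimax_level f x y + e"
proof -
  have "linepath x y \<in> paths_between x y"
    by (simp add: paths_between_def)
  then have "path_max f ` paths_between x y \<noteq> {}"
    by blast
  from cInf_lessD[OF this, of "minimax_level f x y + e"]
  obtain \<eta> where \<eta>: "\<eta> \<in> paths_between x y" "path_max f \<eta> < minimax_level f x y + e"
    using assms unfolding minimax_level_def path_max_def[symmetric] by auto
  then have "continuous_on (cbox 0 1) \<eta>"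
    by (simp add: paths_between_def path_def)
  \<comment> \<open>A path is controlled only on \<open>{0..1}\<close>; its extension to a bounded
    continuous function on the line has the same \<open>path_max\<close>.\<close>
  then obtain \<gamma> :: "real \<Rightarrow>\<^sub>C 'a" where \<gamma>: "\<And>s. s \<in> cbox 0 1 \<Longrightarrow> \<gamma> s = \<eta> s"
    using continuous_on_cbox_bcontfunE by metis
  then have "path_max f \<gamma> = path_max f \<eta>"
    unfolding path_max_def by (intro SUP_cong) auto
  with \<eta> \<gamma>[of 0] \<gamma>[of 1] that[of \<gamma>] show ?thesis
    by (auto simp: paths_between_def pathstart_def pathfinish_def)
qed

lemma continuous_on_bcontfun_evaluation: "continuous_on UNIV (\<lambda>\<gamma>. apply_bcontfun \<gamma> s)"
  unfolding continuous_on_iff by (metis dist_fun_lt_imp_dist_val_lt)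

text \<open>Ekeland's principle is applied to \<open>path_max f\<close> on the bounded continuous
  functions with prescribed values at \<open>0\<close> and \<open>1\<close>, a complete space for
  the sup distance. As the level exceeds both endpoint values, the ends lie strictly below the
  maximum, as the perturbation along the gradient requires.\<close>

lemma minimax_almost_critical:
  fixes f :: "'a::{real_inner, complete_space} \<Rightarrow> real"
  assumes grad: "\<And>x. GDERIV f x :> D x" and cont_D: "continuous_on UNIV D"
    and "minimax_level f x\<^sub>1 x\<^sub>2 > max (f x\<^sub>1) (f x\<^sub>2)" "e > 0"
  obtains \<gamma> s where "path \<gamma>" "\<gamma> 0 = x\<^sub>1" "\<gamma> 1 = x\<^sub>2" "s \<in> {0..1}"
    "\<And>u. u \<in> {0..1} \<Longrightarrow> f (\<gamma> u) \<le> minimax_level f x\<^sub>1 x\<^sub>2 + e"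
    "minimax_level f x\<^sub>1 x\<^sub>2 \<le> f (\<gamma> s)" "norm (D (\<gamma> s)) \<le> e"
proof -
  define c where "c = minimax_level f x\<^sub>1 x\<^sub>2"
  have cont_f: "continuous_on UNIV f"
    using grad by (rule gderiv_continuous_on)
  define S where "S = {\<gamma> :: real \<Rightarrow>\<^sub>C 'a. \<gamma> 0 = x\<^sub>1 \<and> \<gamma> 1 = x\<^sub>2}"
  have paths: "apply_bcontfun \<gamma> \<in> paths_between x\<^sub>1 x\<^sub>2" if "\<gamma> \<in> S" for \<gamma>
    using that by (auto simp: S_def paths_between_def path_def pathstart_def pathfinish_def)
  have c_le: "c \<le> path_max f (apply_bcontfun \<gamma>)" if "\<gamma> \<in> S" for \<gamma>
    unfolding c_def using cont_f paths[OF that] by (rule minimax_level_le_path_max)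
  have "closed S"
    unfolding S_def
    by (intro closed_Collect_conj closed_Collect_eq continuous_on_bcontfun_evaluation continuous_on_const)
  then have "complete S"
    using complete_eq_closed by blast
  \<comment> \<open>\<open>path_max f\<close> is a supremum of the continuous functions evaluating
    \<open>f\<close> at one parameter \<open>s\<close>, so its sublevel sets are intersections of
    closed sets.\<close>
  have lsc: "closed {\<gamma> \<in> S. path_max f (apply_bcontfun \<gamma>) \<le> a}" for a
  proof -
    have "{\<gamma> \<in> S. path_max f (apply_bcontfun \<gamma>) \<le> a} =
        S \<inter> (\<Inter>s\<in>{0..1}. {\<gamma>. f (apply_bcontfun \<gamma> s) \<le> a})"
      using path_max_le_iff[OF cont_f] by auto
    moreover have "closed {\<gamma>. f (apply_bcontfun \<gamma> s) \<le> a}" for s :: real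
    proof (intro closed_Collect_le continuous_on_const)
      show "continuous_on UNIV (\<lambda>\<gamma>. f (apply_bcontfun \<gamma> s))"
        by (rule continuous_on_compose2[OF cont_f continuous_on_bcontfun_evaluation]) simp
    qed
    ultimately show ?thesis
      using \<open>closed S\<close> by (simp add: closed_Int closed_INT)
  qed
  obtain \<gamma>\<^sub>0 :: "real \<Rightarrow>\<^sub>C 'a" where \<gamma>\<^sub>0: "\<gamma>\<^sub>0 0 = x\<^sub>1" "\<gamma>\<^sub>0 1 = x\<^sub>2" "path_max f \<gamma>\<^sub>0 < c + e"
    using path_max_less_minimax_level_add[OF \<open>e > 0\<close>] unfolding c_def by blast
  then have "\<gamma>\<^sub>0 \<in> S"
    by (simp add: S_def)
  obtain \<gamma> where \<gamma>: "\<gamma> \<in> S"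
    "path_max f (apply_bcontfun \<gamma>) + e * dist \<gamma>\<^sub>0 \<gamma> \<le> path_max f (apply_bcontfun \<gamma>\<^sub>0)"
    "\<And>\<eta>. \<eta> \<in> S \<Longrightarrow>
      path_max f (apply_bcontfun \<gamma>) - e * dist \<gamma> \<eta> \<le> path_max f (apply_bcontfun \<eta>)"
    using ekeland_variational_principle[OF \<open>complete S\<close> \<open>\<gamma>\<^sub>0 \<in> S\<close> \<open>e > 0\<close> lsc c_le] by blast
  have ends: "apply_bcontfun \<gamma> 0 = x\<^sub>1" "apply_bcontfun \<gamma> 1 = x\<^sub>2"
    using \<gamma>(1) by (auto simp: S_def)
  have "path_max f (apply_bcontfun \<gamma>) \<le> c + e"
    using \<gamma>(2) \<gamma>\<^sub>0(3) \<open>e > 0\<close> by (smt (verit) mult_nonneg_nonneg zero_le_dist)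
  then have le: "f (apply_bcontfun \<gamma> u) \<le> c + e" if "u \<in> {0..1}" for u
    using path_max_le_iff[OF cont_f] that by auto
  obtain s where s: "s \<in> {0..1}" "f (apply_bcontfun \<gamma> s) = path_max f (apply_bcontfun \<gamma>)"
    "norm (D (apply_bcontfun \<gamma> s)) \<le> e"
  proof (rule almost_critical_point_on_path[OF grad cont_D _ _ \<open>e > 0\<close>])
    show "f (apply_bcontfun \<gamma> 0) < path_max f (apply_bcontfun \<gamma>)"
      and "f (apply_bcontfun \<gamma> 1) < path_max f (apply_bcontfun \<gamma>)"
      using assms(3) c_le[OF \<gamma>(1)] by (simp_all add: ends c_def)
    show "path_max f (apply_bcontfun \<gamma>) - e * dist \<gamma> \<eta> \<le> path_max f (apply_bcontfun \<eta>)"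
      if "apply_bcontfun \<eta> 0 = apply_bcontfun \<gamma> 0" "apply_bcontfun \<eta> 1 = apply_bcontfun \<gamma> 1" for \<eta>
      using that by (intro \<gamma>(3)) (simp add: S_def ends)
  qed
  with that[of "apply_bcontfun \<gamma>" s] le ends c_le[OF \<gamma>(1)] show ?thesis
    by (simp add: path_def c_def)
qed

section \<open>Almost minima and limits of Palais-Smale sequences\<close>

text \<open>Ekeland's principle is applied on \<open>cball y \<rho>\<close>. Values there are at
  least \<open>c\<close>, so the slack \<open>e * \<rho>\<close> limits the distance from
  \<open>y\<close> and keeps \<open>z\<close> in the interior, where the derivative bound holds;
  testing it with \<open>D z\<close> bounds the gradient.\<close>

lemma almost_critical_near_almost_minimum:
  fixes f :: "'a::{real_inner, complete_space} \<Rightarrow> real"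
  assumes grad: "\<And>x. GDERIV f x :> D x" and "\<rho> > 0" "e > 0"
    and f_ge: "\<And>w. w \<in> cball y \<rho> \<Longrightarrow> c \<le> f w" and f_y: "f y < c + e * \<rho>"
  obtains z where "dist y z < \<rho>" "norm (D z) \<le> e" "f z \<le> f y"
proof -
  have cont_f: "continuous_on UNIV f"
    using grad by (rule gderiv_continuous_on)
  have closed: "closed {w \<in> cball y \<rho>. f w \<le> a}" for a
    using closed_Int[OF closed_cball closed_Collect_le[OF cont_f continuous_on_const], of y \<rho> a]
    by (simp add: Int_def)
  have complete: "complete (cball y \<rho>)"
    using complete_eq_closed by blast
  have "y \<in> cball y \<rho>"
    using \<open>\<rho> > 0\<close> by simp
  from ekeland_variational_principle[OF complete this \<open>e > 0\<close> closed f_ge]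
  obtain z where z: "z \<in> cball y \<rho>" "f z + e * dist y z \<le> f y"
    "\<And>w. w \<in> cball y \<rho> \<Longrightarrow> f z - e * dist z w \<le> f w"
    by blast
  have "e * dist y z < e * \<rho>"
    using z(2) f_y f_ge[OF z(1)] by simp
  then have dist_z: "dist y z < \<rho>"
    using \<open>e > 0\<close> by simp
  then have "z \<in> interior (cball y \<rho>)"
    using interior_maximal[OF ball_subset_cball open_ball] by force
  then have "\<bar>D z \<bullet> D z\<bar> \<le> e * norm (D z)"
    using derivative_bound_at_almost_minimum[OF grad[of z, unfolded gderiv_def] _ z(3)] by blast
  then have "norm (D z) * norm (D z) \<le> e * norm (D z)"
    by (simp add: power2_eq_square flip: power2_norm_eq_inner)
  then have "norm (D z) \<le> e"
    using \<open>e > 0\<close> by (cases "D z = 0") auto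
  moreover have "0 \<le> e * dist y z"
    using \<open>e > 0\<close> by simp
  with z(2) have "f z \<le> f y"
    by linarith
  ultimately show ?thesis
    using that dist_z by blast
qed

lemma Palais_Smale_conditionE:
  fixes f :: "'a::real_inner \<Rightarrow> real"
  assumes "Palais_Smale_condition f c"
    and grad: "\<And>x. GDERIV f x :> D x" and cont_D: "continuous_on UNIV D"
    and "(\<lambda>n. f (X n)) \<longlonglongrightarrow> c" "(\<lambda>n. D (X n)) \<longlonglongrightarrow> 0"
  obtains r x where "strict_mono r" "(X \<circ> r) \<longlonglongrightarrow> x" "D x = 0" "f x = c"
proof -
  have "Palais_Smale_seq f c X"
    unfolding Palais_Smale_seq_def using assms(4,5) grad by (intro conjI exI[of _ "\<lambda>n. D (X n)"]) auto
  then obtain r x where r: "strict_mono r" "(X \<circ> r) \<longlonglongrightarrow> x"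
    using assms(1) unfolding Palais_Smale_condition_def convergent_def by blast
  have "isCont f x"
    using grad[of x] has_derivative_continuous unfolding gderiv_def by blast
  then have "(\<lambda>n. f (X (r n))) \<longlonglongrightarrow> f x"
    using isCont_tendsto_compose[OF _ r(2)] by (simp add: o_def)
  moreover have "(\<lambda>n. f (X (r n))) \<longlonglongrightarrow> c"
    using LIMSEQ_subseq_LIMSEQ[OF assms(4) r(1)] by (simp add: o_def)
  ultimately have "f x = c"
    by (rule LIMSEQ_unique)
  have "isCont D x"
    using cont_D by (simp add: continuous_on_eq_continuous_at)
  then have "(\<lambda>n. D (X (r n))) \<longlonglongrightarrow> D x"
    using isCont_tendsto_compose[OF _ r(2)] by (simp add: o_def)
  moreover have "(\<lambda>n. D (X (r n))) \<longlonglongrightarrow> 0"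
    using LIMSEQ_subseq_LIMSEQ[OF assms(5) r(1)] by (simp add: o_def)
  ultimately have "D x = 0"
    by (rule LIMSEQ_unique)
  with that r \<open>f x = c\<close> show ?thesis
    by blast
qed

text \<open>In this form the failure of minimality is a closed condition among points at one fixed
  level, so it survives limits.\<close>

lemma not_local_minimizer_iff: "\<not> local_minimizer f x \<longleftrightarrow> x \<in> closure {y. f y < f x}"
  by (simp add: local_minimizer_def closure_approachable Bex_def dist_commute not_le conj_commute)

section \<open>Critical points approaching the closure of the strict sublevel set\<close>

theorem theorem2p1:
  fixes f :: "'a::{real_inner, complete_space} \<Rightarrow> real"
    and x\<^sub>1 x\<^sub>2 :: 'a
    and c\<^sub>0 :: real
  assumes "C2_functional f"
    and "x\<^sub>1 \<noteq> x\<^sub>2"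
    and "c\<^sub>0 = minimax_level f x\<^sub>1 x\<^sub>2"
    and "c\<^sub>0 > max (f x\<^sub>1) (f x\<^sub>2)"
    and "Palais_Smale_condition f c\<^sub>0"
  shows "\<exists>x\<^sub>0. critical_point f x\<^sub>0 \<and> f x\<^sub>0 = c\<^sub>0 \<and> \<not> local_minimizer f x\<^sub>0"
proof -
  obtain D where grad: "\<And>x. GDERIV f x :> D x" and cont_D: "continuous_on UNIV D"
    using C2_functional_gradient[OF assms(1)] by blast
  have cont_f: "continuous_on UNIV f"
    using grad by (rule gderiv_continuous_on)
  define F where "F = closure {y. f y < c\<^sub>0}"
  have "x\<^sub>1 \<in> F"
    using assms(4) closure_subset unfolding F_def by fastforce
  have "closed F"
    by (simp add: F_def)
  \<comment> \<open>\<open>infdist\<close> to the empty set is \<open>0\<close> by default;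
    \<open>x\<^sub>1 \<in> F\<close> excludes that case.\<close>
  have F_iff: "infdist x F = 0 \<longleftrightarrow> x \<in> F" for x
    using in_closed_iff_infdist_zero[OF \<open>closed F\<close>] \<open>x\<^sub>1 \<in> F\<close> by (metis empty_iff)
  have goal: ?thesis if "D x = 0" "f x = c\<^sub>0" "x \<in> F" for x
  proof (intro exI conjI)
    show "critical_point f x"
      using grad[of x] that(1) by (simp add: critical_point_def)
    show "\<not> local_minimizer f x"
      using that unfolding not_local_minimizer_iff F_def by simp
  qed fact
  have lim_I: "X \<longlonglongrightarrow> l" if "\<And>n. dist (X n) l \<le> 1 / real (Suc n)"
    for X :: "nat \<Rightarrow> 'b::metric_space" and l
  proof -
    have "(\<lambda>n. dist (X n) l) \<longlonglongrightarrow> 0"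
      using that by (intro Lim_null_comparison[OF _ LIMSEQ_Suc[OF lim_1_over_n]]) auto
    then show ?thesis
      by (rule iffD2[OF tendsto_dist_iff])
  qed
  have "\<exists>\<gamma> s. path \<gamma> \<and> \<gamma> 0 = x\<^sub>1 \<and> \<gamma> 1 = x\<^sub>2 \<and> s \<in> {0..1} \<and>
      (\<forall>u\<in>{0..1}. f (\<gamma> u) \<le> c\<^sub>0 + 1 / real (Suc n)) \<and>
      c\<^sub>0 \<le> f (\<gamma> s) \<and> norm (D (\<gamma> s)) \<le> 1 / real (Suc n)" for n
    using minimax_almost_critical[OF grad cont_D assms(4)[unfolded assms(3)], of "1 / real (Suc n)"]
      assms(3) by (metis of_nat_0_less_iff zero_less_Suc zero_less_divide_1_iff)
  then obtain \<gamma> s where \<gamma>: "\<And>n. path (\<gamma> n)" "\<And>n. \<gamma> n 0 = x\<^sub>1" "\<And>n. \<gamma> n 1 = x\<^sub>2"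
    "\<And>n. s n \<in> {0..1}"
    "\<And>n u. u \<in> {0..1} \<Longrightarrow> f (\<gamma> n u) \<le> c\<^sub>0 + 1 / real (Suc n)"
    "\<And>n. c\<^sub>0 \<le> f (\<gamma> n (s n))" "\<And>n. norm (D (\<gamma> n (s n))) \<le> 1 / real (Suc n)"
    by metis
  have "(\<lambda>n. f (\<gamma> n (s n))) \<longlonglongrightarrow> c\<^sub>0"
    using \<gamma>(5)[OF \<gamma>(4)] \<gamma>(6) by (intro lim_I) (simp add: dist_real_def algebra_simps)
  moreover have "(\<lambda>n. D (\<gamma> n (s n))) \<longlonglongrightarrow> 0"
    using \<gamma>(7) by (intro lim_I) simp
  ultimately obtain r x where x: "strict_mono r" "((\<lambda>n. \<gamma> n (s n)) \<circ> r) \<longlonglongrightarrow> x" "D x = 0" "f x = c\<^sub>0"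
    by (rule Palais_Smale_conditionE[OF assms(5) grad cont_D])
  show ?thesis
  proof (cases "x \<in> F")
    case True
    with goal x show ?thesis by blast
  next
    case False
    then have "infdist x F > 0"
      using F_iff infdist_nonneg by (metis less_eq_real_def)
    have almost: "\<exists>z. norm (D z) \<le> e \<and> \<bar>f z - c\<^sub>0\<bar> \<le> e \<and> \<bar>infdist z F - \<delta>\<bar> \<le> e"
      if "0 < \<delta>" "\<delta> < infdist x F" "e > 0" for \<delta> e
    proof -
      \<comment> \<open>\<open>\<rho> \<le> \<delta> / 2\<close> keeps the ball around
        \<open>y\<close> away from \<open>F\<close>, and \<open>\<rho> \<le> e\<close> controls the
        change of \<open>infdist\<close>. \<open>\<theta> \<le> e\<close> controls the values of
        \<open>f\<close>, and \<open>\<theta> \<le> e * \<rho> / 2\<close> gives the strict slack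
        needed on the ball.\<close>
      define \<rho> where "\<rho> = min e (\<delta> / 2)"
      define \<theta> where "\<theta> = min e (e * \<rho> / 2)"
      have "\<rho> > 0" "\<theta> > 0"
        using that by (auto simp: \<rho>_def \<theta>_def)
      \<comment> \<open>The limit \<open>x\<close> is farther than \<open>\<delta>\<close> from
        \<open>F\<close>, hence so are the almost critical points far along the subsequence. The
        index \<open>n\<close> obtained below is a value of \<open>r\<close>.\<close>
      have "(\<lambda>n. infdist (\<gamma> (r n) (s (r n))) F) \<longlonglongrightarrow> infdist x F"
        using tendsto_infdist[OF x(2)] by (simp add: o_def)
      then have "\<forall>\<^sub>F n in sequentially. infdist (\<gamma> (r n) (s (r n))) F > \<delta>"
        using that(2) by (rule order_tendstoD)
      moreover have "(\<lambda>n. 1 / real (Suc (r n))) \<longlonglongrightarrow> 0"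
        using LIMSEQ_subseq_LIMSEQ[OF LIMSEQ_Suc[OF lim_1_over_n] x(1)] by (simp add: o_def)
      then have "\<forall>\<^sub>F n in sequentially. 1 / real (Suc (r n)) < \<theta>"
        using \<open>\<theta> > 0\<close> by (rule order_tendstoD)
      ultimately have "\<forall>\<^sub>F n in sequentially. infdist (\<gamma> (r n) (s (r n))) F > \<delta> \<and> 1 / real (Suc (r n)) < \<theta>"
        by eventually_elim simp
      then obtain n where n: "infdist (\<gamma> n (s n)) F > \<delta>" "1 / real (Suc n) < \<theta>"
        by (auto simp: eventually_sequentially)
      have "continuous_on {0..s n} (\<gamma> n)"
        using \<gamma>(1,4)[of n] unfolding path_def by (auto intro: continuous_on_subset)
      then have "continuous_on {0..s n} (\<lambda>u. infdist (\<gamma> n u) F)"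
        by (rule continuous_on_infdist)
      \<comment> \<open>The distance to \<open>F\<close> is \<open>0\<close> at the start
        \<open>x\<^sub>1\<close> and exceeds \<open>\<delta>\<close> at \<open>s n\<close>, so it
        equals \<open>\<delta>\<close> in between.\<close>
      then obtain u where u: "0 \<le> u" "u \<le> s n" "infdist (\<gamma> n u) F = \<delta>"
        using IVT'[of "\<lambda>u. infdist (\<gamma> n u) F" 0 \<delta> "s n"] n(1) \<gamma>(2,4)[of n] \<open>0 < \<delta>\<close> \<open>x\<^sub>1 \<in> F\<close>
        by auto
      define y where "y = \<gamma> n u"
      have f_y: "f y \<le> c\<^sub>0 + \<theta>"
        using \<gamma>(5)[of u n] u \<gamma>(4)[of n] n(2) unfolding y_def by force
      have dist_F: "\<bar>infdist w F - \<delta>\<bar> \<le> dist y w" for w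
        using infdist_triangle_abs[of w F y] u(3) by (simp add: y_def dist_commute)
      have f_ge: "c\<^sub>0 \<le> f w" if "w \<in> cball y \<rho>" for w
      proof -
        have "infdist w F > 0"
          using dist_F[of w] that \<open>0 < \<delta>\<close> unfolding \<rho>_def mem_cball by linarith
        then have "w \<notin> F"
          using F_iff by force
        then show ?thesis
          using closure_subset[of "{y. f y < c\<^sub>0}"] unfolding F_def by force
      qed
      have "\<theta> < e * \<rho>"
        using \<open>e > 0\<close> \<open>\<rho> > 0\<close> mult_pos_pos[of e \<rho>] unfolding \<theta>_def by linarith
      with f_y have "f y < c\<^sub>0 + e * \<rho>"
        by simp
      then obtain z where z: "dist y z < \<rho>" "norm (D z) \<le> e" "f z \<le> f y"
        using almost_critical_near_almost_minimum[OF grad \<open>\<rho> > 0\<close> \<open>e > 0\<close> f_ge] by blast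
      then have "c\<^sub>0 \<le> f z"
        by (intro f_ge) simp
      with z(3) f_y have "\<bar>f z - c\<^sub>0\<bar> \<le> e"
        by (simp add: \<theta>_def)
      moreover have "\<bar>infdist z F - \<delta>\<bar> \<le> e"
        using dist_F[of z] z(1) unfolding \<rho>_def by linarith
      ultimately show ?thesis
        using z(2) by blast
    qed
    have level: "\<exists>z. D z = 0 \<and> f z = c\<^sub>0 \<and> infdist z F = \<delta>" if \<delta>: "0 < \<delta>" "\<delta> < infdist x F" for \<delta>
    proof -
      have "\<exists>z. norm (D z) \<le> 1 / real (Suc n) \<and> \<bar>f z - c\<^sub>0\<bar> \<le> 1 / real (Suc n) \<and>
          \<bar>infdist z F - \<delta>\<bar> \<le> 1 / real (Suc n)" for n
        by (intro almost \<delta>) simp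
      then obtain Z where Z: "\<And>n. norm (D (Z n)) \<le> 1 / real (Suc n)"
        "\<And>n. \<bar>f (Z n) - c\<^sub>0\<bar> \<le> 1 / real (Suc n)" "\<And>n. \<bar>infdist (Z n) F - \<delta>\<bar> \<le> 1 / real (Suc n)"
        by metis
      have inf: "(\<lambda>n. infdist (Z n) F) \<longlonglongrightarrow> \<delta>"
        using Z(3) by (auto intro!: lim_I simp: dist_real_def)
      have "(\<lambda>n. f (Z n)) \<longlonglongrightarrow> c\<^sub>0" "(\<lambda>n. D (Z n)) \<longlonglongrightarrow> 0"
        using Z by (auto intro!: lim_I simp: dist_real_def)
      then obtain q z where z: "strict_mono q" "(Z \<circ> q) \<longlonglongrightarrow> z" "D z = 0" "f z = c\<^sub>0"
        by (rule Palais_Smale_conditionE[OF assms(5) grad cont_D])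
      have "(\<lambda>n. infdist ((Z \<circ> q) n) F) \<longlonglongrightarrow> infdist z F"
        by (rule tendsto_infdist[OF z(2)])
      moreover have "(\<lambda>n. infdist ((Z \<circ> q) n) F) \<longlonglongrightarrow> \<delta>"
        using LIMSEQ_subseq_LIMSEQ[OF inf z(1)] by (simp add: o_def)
      ultimately have "infdist z F = \<delta>"
        by (rule LIMSEQ_unique)
      with z show ?thesis
        by blast
    qed
    \<comment> \<open>The denominator starts at \<open>2\<close>, so that the distance is strictly
      below \<open>infdist x F\<close> already for \<open>n = 0\<close>.\<close>
    have "\<exists>z. D z = 0 \<and> f z = c\<^sub>0 \<and> infdist z F = infdist x F / real (Suc (Suc n))" for n
      using \<open>infdist x F > 0\<close> by (intro level) (auto simp: field_simps add_pos_nonneg)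
    then obtain Z where Z: "\<And>n. D (Z n) = 0" "\<And>n. f (Z n) = c\<^sub>0"
      "\<And>n. infdist (Z n) F = infdist x F / real (Suc (Suc n))"
      by metis
    \<comment> \<open>Exact critical points at the level form a Palais-Smale sequence trivially; a
      limit of a subsequence has distance \<open>0\<close> from \<open>F\<close>.\<close>
    have "(\<lambda>n. f (Z n)) \<longlonglongrightarrow> c\<^sub>0" "(\<lambda>n. D (Z n)) \<longlonglongrightarrow> 0"
      by (simp_all add: Z)
    then obtain q z where z: "strict_mono q" "(Z \<circ> q) \<longlonglongrightarrow> z" "D z = 0" "f z = c\<^sub>0"
      by (rule Palais_Smale_conditionE[OF assms(5) grad cont_D])
    have "(\<lambda>n. infdist ((Z \<circ> q) n) F) \<longlonglongrightarrow> infdist z F"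
      by (rule tendsto_infdist[OF z(2)])
    moreover have "(\<lambda>n. infdist (Z n) F) \<longlonglongrightarrow> 0"
      unfolding Z(3) by (intro LIMSEQ_Suc[of "\<lambda>n. infdist x F / real (Suc n)"] LIMSEQ_Suc lim_const_over_n)
    from LIMSEQ_subseq_LIMSEQ[OF this z(1)] have "(\<lambda>n. infdist ((Z \<circ> q) n) F) \<longlonglongrightarrow> 0"
      by (simp add: o_def)
    ultimately have "infdist z F = 0"
      by (rule LIMSEQ_unique)
    then show ?thesis
      using goal z F_iff by blast
  qed
qed

end
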